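(* Let $\Omega$ be an index set, let $\{A_i\}_{i\in\Omega}$ be a family of MV-algebras, and let $A=\prod_{i\in\Omega}A_i$ be their direct product. If $I_i$ is an ideal of $A_i$ for each $i\in\Omega$, then the cartesian product $\prod_{i\in\Omega}I_i$ of the sets $I_i$ is an ideal of $A$, and $A/\bigl(\prod_{i\in\Omega}I_i\bigr)\cong\prod_{i\in\Omega}(A_i/I_i)$ as MV-algebras.
   Context: An MV-algebra is an algebra $(A,\oplus,*,0)$ of type $(2,1,0)$ such that $(A,\oplus,0)$ is a commutative monoid, $x^{**}=x$, $x\oplus 0^*=0^*$, and $(x^*\oplus y)^*\oplus y=(y^*\oplus x)^*\oplus x$ for all $x,y$. Put $1=0^*$, $x\odot y=(x^*\oplus y^* )^*$, and $x\le y$ iff $x^*\oplus y=1$ (a partial order). The direct product of MV-algebras is the cartesian product with pointwise operations. An ideal of $A$ is a subset $I\subseteq A$ with $0\in I$; $a,b\in I$ implies $a\oplus b\in I$; and $b\in I$, $a\le b$ implies $a\in I$. For an ideal $I$, with $d(x,y)=(x\odot y^* )\oplus(y\odot x^* )$, the relation $x\equiv_I y\iff d(x,y)\in I$ is a congruence on $A$; $x/I$ denotes the class of $x$, and $A/I$ is the quotient MV-algebra with operations $(x/I)\oplus(y/I)=(x\oplus y)/I$, $(x/I)^*=x^*/I$ and zero $0/I$. *)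

theory Defs
  imports "HOL-Algebra.Group" "HOL-Library.FuncSet"
begin

record 'a mv_struct = "'a partial_object" +
  mv_plus :: "'a \<Rightarrow> 'a \<Rightarrow> 'a" (infixl \<open>\<oplus>\<^sub>M\<index>\<close> 65)
  mv_neg :: "'a \<Rightarrow> 'a" (\<open>\<sim>\<^sub>M\<index> _\<close> [81] 80)
  mv_zero :: 'a (\<open>\<zero>\<^sub>M\<index>\<close>)

definition mv_one :: "('a, 'm) mv_struct_scheme \<Rightarrow> 'a" (\<open>\<one>\<^sub>M\<index>\<close>)
  where "\<one>\<^sub>M\<^bsub>A\<^esub> = \<sim>\<^sub>M\<^bsub>A\<^esub> \<zero>\<^sub>M\<^bsub>A\<^esub>"

definition mv_times :: "('a, 'm) mv_struct_scheme \<Rightarrow> 'a \<Rightarrow> 'a \<Rightarrow> 'a" (infixl \<open>\<odot>\<^sub>M\<index>\<close> 70)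
  where "x \<odot>\<^sub>M\<^bsub>A\<^esub> y = \<sim>\<^sub>M\<^bsub>A\<^esub> (\<sim>\<^sub>M\<^bsub>A\<^esub> x \<oplus>\<^sub>M\<^bsub>A\<^esub> \<sim>\<^sub>M\<^bsub>A\<^esub> y)"

definition mv_le :: "('a, 'm) mv_struct_scheme \<Rightarrow> 'a \<Rightarrow> 'a \<Rightarrow> bool" (infix \<open>\<le>\<^sub>M\<index>\<close> 50)
  where "x \<le>\<^sub>M\<^bsub>A\<^esub> y \<longleftrightarrow> \<sim>\<^sub>M\<^bsub>A\<^esub> x \<oplus>\<^sub>M\<^bsub>A\<^esub> y = \<one>\<^sub>M\<^bsub>A\<^esub>"

definition mv_dist :: "('a, 'm) mv_struct_scheme \<Rightarrow> 'a \<Rightarrow> 'a \<Rightarrow> 'a"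
  where "mv_dist A x y =
    (x \<odot>\<^sub>M\<^bsub>A\<^esub> \<sim>\<^sub>M\<^bsub>A\<^esub> y) \<oplus>\<^sub>M\<^bsub>A\<^esub> (y \<odot>\<^sub>M\<^bsub>A\<^esub> \<sim>\<^sub>M\<^bsub>A\<^esub> x)"

locale mv_algebra =
  fixes A :: "('a, 'm) mv_struct_scheme" (structure)
  assumes comm_monoid_plus:
      "comm_monoid \<lparr>carrier = carrier A, mult = mv_plus A, one = mv_zero A\<rparr>"
    and neg_closed [simp, intro]: "x \<in> carrier A \<Longrightarrow> \<sim>\<^sub>M x \<in> carrier A"
    and neg_neg [simp]: "x \<in> carrier A \<Longrightarrow> \<sim>\<^sub>M (\<sim>\<^sub>M x) = x"
    and plus_neg_zero: "x \<in> carrier A \<Longrightarrow> x \<oplus>\<^sub>M \<sim>\<^sub>M \<zero>\<^sub>M = \<sim>\<^sub>M \<zero>\<^sub>M"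
    and luk: "\<lbrakk>x \<in> carrier A; y \<in> carrier A\<rbrakk>
      \<Longrightarrow> \<sim>\<^sub>M (\<sim>\<^sub>M x \<oplus>\<^sub>M y) \<oplus>\<^sub>M y = \<sim>\<^sub>M (\<sim>\<^sub>M y \<oplus>\<^sub>M x) \<oplus>\<^sub>M x"

locale mv_ideal = mv_algebra A
  for I :: "'a set" and A :: "('a, 'm) mv_struct_scheme" (structure) +
  assumes ideal_subset: "I \<subseteq> carrier A"
    and ideal_zero: "\<zero>\<^sub>M \<in> I"
    and ideal_plus: "\<lbrakk>a \<in> I; b \<in> I\<rbrakk> \<Longrightarrow> a \<oplus>\<^sub>M b \<in> I"
    and ideal_down: "\<lbrakk>b \<in> I; a \<in> carrier A; a \<le>\<^sub>M b\<rbrakk> \<Longrightarrow> a \<in> I"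

text \<open>All factors have their carriers in one common type, which may be arbitrary. Elements of the product
  are extensional, i.e. determined by their values on the index set.\<close>

definition mv_product :: "'i set \<Rightarrow> ('i \<Rightarrow> ('a, 'm) mv_struct_scheme) \<Rightarrow> ('i \<Rightarrow> 'a) mv_struct"
  where "mv_product \<Omega> A =
    \<lparr>carrier = (\<Pi>\<^sub>E i\<in>\<Omega>. carrier (A i)),
     mv_plus = (\<lambda>f g. \<lambda>i\<in>\<Omega>. f i \<oplus>\<^sub>M\<^bsub>A i\<^esub> g i),
     mv_neg = (\<lambda>f. \<lambda>i\<in>\<Omega>. \<sim>\<^sub>M\<^bsub>A i\<^esub> f i),
     mv_zero = (\<lambda>i\<in>\<Omega>. \<zero>\<^sub>M\<^bsub>A i\<^esub>)\<rparr>"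

definition mv_cong :: "('a, 'm) mv_struct_scheme \<Rightarrow> 'a set \<Rightarrow> 'a rel"
  where "mv_cong A I = {(x, y). x \<in> carrier A \<and> y \<in> carrier A \<and> mv_dist A x y \<in> I}"

definition mv_class :: "('a, 'm) mv_struct_scheme \<Rightarrow> 'a set \<Rightarrow> 'a \<Rightarrow> 'a set"
  where "mv_class A I x = mv_cong A I `` {x}"

text \<open>The unions below run over all representatives of the argument classes. As the relation is a
  congruence, all sets in such a union coincide, so the operations take the expected values on
  classes; see \<open>quot_plus\<close> and \<open>quot_neg\<close> below.\<close>

definition mv_quot :: "('a, 'm) mv_struct_scheme \<Rightarrow> 'a set \<Rightarrow> 'a set mv_struct"
  where "mv_quot A I =
    \<lparr>carrier = carrier A // mv_cong A I,
     mv_plus = (\<lambda>X Y. \<Union>x\<in>X. \<Union>y\<in>Y. mv_class A I (x \<oplus>\<^sub>M\<^bsub>A\<^esub> y)),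
     mv_neg = (\<lambda>X. \<Union>x\<in>X. mv_class A I (\<sim>\<^sub>M\<^bsub>A\<^esub> x)),
     mv_zero = mv_class A I \<zero>\<^sub>M\<^bsub>A\<^esub>\<rparr>"

definition mv_hom :: "('a, 'm) mv_struct_scheme \<Rightarrow> ('b, 'n) mv_struct_scheme \<Rightarrow> ('a \<Rightarrow> 'b) set"
  where "mv_hom A B = {h \<in> carrier A \<rightarrow> carrier B.
    (\<forall>x\<in>carrier A. \<forall>y\<in>carrier A. h (x \<oplus>\<^sub>M\<^bsub>A\<^esub> y) = h x \<oplus>\<^sub>M\<^bsub>B\<^esub> h y) \<and>
    (\<forall>x\<in>carrier A. h (\<sim>\<^sub>M\<^bsub>A\<^esub> x) = \<sim>\<^sub>M\<^bsub>B\<^esub> h x) \<and>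
    h \<zero>\<^sub>M\<^bsub>A\<^esub> = \<zero>\<^sub>M\<^bsub>B\<^esub>}"

definition mv_isomorphic :: "('a, 'm) mv_struct_scheme \<Rightarrow> ('b, 'n) mv_struct_scheme \<Rightarrow> bool"
    (infix \<open>\<cong>\<^sub>M\<close> 50)
  where "A \<cong>\<^sub>M B \<longleftrightarrow> (\<exists>h \<in> mv_hom A B. bij_betw h (carrier A) (carrier B))"

context mv_algebra
begin

interpretation P: comm_monoid "\<lparr>carrier = carrier A, mult = mv_plus A, one = mv_zero A\<rparr>"
  by (rule comm_monoid_plus)

lemma plus_closed [simp, intro]:
  "\<lbrakk>x \<in> carrier A; y \<in> carrier A\<rbrakk> \<Longrightarrow> x \<oplus>\<^sub>M y \<in> carrier A"
  using P.m_closed by simp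

lemma zero_closed [simp, intro]: "\<zero>\<^sub>M \<in> carrier A"
  using P.one_closed by simp

lemma one_closed [simp, intro]: "\<one>\<^sub>M \<in> carrier A"
  by (simp add: mv_one_def)

lemma plus_assoc:
  "\<lbrakk>x \<in> carrier A; y \<in> carrier A; z \<in> carrier A\<rbrakk> \<Longrightarrow> x \<oplus>\<^sub>M y \<oplus>\<^sub>M z = x \<oplus>\<^sub>M (y \<oplus>\<^sub>M z)"
  using P.m_assoc by simp

lemma plus_comm: "\<lbrakk>x \<in> carrier A; y \<in> carrier A\<rbrakk> \<Longrightarrow> x \<oplus>\<^sub>M y = y \<oplus>\<^sub>M x"
  using P.m_comm by simp

lemma plus_left_comm:
  "\<lbrakk>x \<in> carrier A; y \<in> carrier A; z \<in> carrier A\<rbrakk> \<Longrightarrow> x \<oplus>\<^sub>M (y \<oplus>\<^sub>M z) = y \<oplus>\<^sub>M (x \<oplus>\<^sub>M z)"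
  using P.m_lcomm by simp

lemmas plus_ac = plus_assoc plus_comm plus_left_comm

lemma zero_plus [simp]: "x \<in> carrier A \<Longrightarrow> \<zero>\<^sub>M \<oplus>\<^sub>M x = x"
  using P.l_one by simp

lemma plus_zero [simp]: "x \<in> carrier A \<Longrightarrow> x \<oplus>\<^sub>M \<zero>\<^sub>M = x"
  using P.r_one by simp

lemma plus_one [simp]: "x \<in> carrier A \<Longrightarrow> x \<oplus>\<^sub>M \<one>\<^sub>M = \<one>\<^sub>M"
  by (simp add: mv_one_def plus_neg_zero)

lemma one_plus [simp]: "x \<in> carrier A \<Longrightarrow> \<one>\<^sub>M \<oplus>\<^sub>M x = \<one>\<^sub>M"
  by (simp add: plus_comm[of "\<one>\<^sub>M"])

lemma neg_one [simp]: "\<sim>\<^sub>M \<one>\<^sub>M = \<zero>\<^sub>M"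
  by (simp add: mv_one_def)

lemma neg_plus_self [simp]: "x \<in> carrier A \<Longrightarrow> \<sim>\<^sub>M x \<oplus>\<^sub>M x = \<one>\<^sub>M"
  using luk[of x "\<one>\<^sub>M"] by simp

lemma le_iff_plus:
  assumes "x \<in> carrier A" "y \<in> carrier A"
  shows "x \<le>\<^sub>M y \<longleftrightarrow> (\<exists>w\<in>carrier A. y = x \<oplus>\<^sub>M w)"
proof
  assume "x \<le>\<^sub>M y"
  then have "y = \<sim>\<^sub>M (\<sim>\<^sub>M y \<oplus>\<^sub>M x) \<oplus>\<^sub>M x"
    using luk[OF assms] assms by (simp add: mv_le_def)
  also have "\<dots> = x \<oplus>\<^sub>M \<sim>\<^sub>M (\<sim>\<^sub>M y \<oplus>\<^sub>M x)"
    using assms by (intro plus_comm) auto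
  finally show "\<exists>w\<in>carrier A. y = x \<oplus>\<^sub>M w"
    using assms by blast
next
  assume "\<exists>w\<in>carrier A. y = x \<oplus>\<^sub>M w"
  then obtain w where w: "w \<in> carrier A" "y = x \<oplus>\<^sub>M w" by blast
  then have "\<sim>\<^sub>M x \<oplus>\<^sub>M y = (\<sim>\<^sub>M x \<oplus>\<^sub>M x) \<oplus>\<^sub>M w"
    using assms by (simp only: plus_assoc neg_closed)
  then show "x \<le>\<^sub>M y" using assms w by (simp add: mv_le_def)
qed

lemma le_trans:
  assumes "x \<le>\<^sub>M y" "y \<le>\<^sub>M z" "x \<in> carrier A" "y \<in> carrier A" "z \<in> carrier A"
  shows "x \<le>\<^sub>M z"
proof -
  obtain w t where "w \<in> carrier A" "y = x \<oplus>\<^sub>M w" "t \<in> carrier A" "z = y \<oplus>\<^sub>M t"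
    using assms le_iff_plus by metis
  then have "w \<oplus>\<^sub>M t \<in> carrier A" "z = x \<oplus>\<^sub>M (w \<oplus>\<^sub>M t)"
    using assms by (simp_all only: plus_assoc plus_closed)
  then show ?thesis using assms le_iff_plus by blast
qed

lemma plus_mono:
  assumes "x \<le>\<^sub>M y" "u \<le>\<^sub>M v"
    and c: "x \<in> carrier A" "y \<in> carrier A" "u \<in> carrier A" "v \<in> carrier A"
  shows "x \<oplus>\<^sub>M u \<le>\<^sub>M y \<oplus>\<^sub>M v"
proof -
  obtain w t where w: "w \<in> carrier A" "y = x \<oplus>\<^sub>M w" and t: "t \<in> carrier A" "v = u \<oplus>\<^sub>M t"
    using assms le_iff_plus by metis
  then have "y \<oplus>\<^sub>M v = x \<oplus>\<^sub>M u \<oplus>\<^sub>M (w \<oplus>\<^sub>M t)"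
    using c by (simp add: plus_ac)
  then show ?thesis using w t c le_iff_plus plus_closed by metis
qed

lemma times_neg: "\<lbrakk>x \<in> carrier A; y \<in> carrier A\<rbrakk> \<Longrightarrow> x \<odot>\<^sub>M \<sim>\<^sub>M y = \<sim>\<^sub>M (\<sim>\<^sub>M x \<oplus>\<^sub>M y)"
  by (simp add: mv_times_def)

lemma times_closed [simp, intro]:
  "\<lbrakk>x \<in> carrier A; y \<in> carrier A\<rbrakk> \<Longrightarrow> x \<odot>\<^sub>M y \<in> carrier A"
  by (simp add: mv_times_def)

lemma times_neg_le_iff:
  assumes "x \<in> carrier A" "y \<in> carrier A" "w \<in> carrier A"
  shows "x \<odot>\<^sub>M \<sim>\<^sub>M y \<le>\<^sub>M w \<longleftrightarrow> x \<le>\<^sub>M y \<oplus>\<^sub>M w"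
  using assms by (simp add: times_neg mv_le_def plus_assoc)

lemma le_refl [simp]: "x \<in> carrier A \<Longrightarrow> x \<le>\<^sub>M x"
  by (simp add: mv_le_def)

lemma le_plus_times_neg:
  "\<lbrakk>x \<in> carrier A; y \<in> carrier A\<rbrakk> \<Longrightarrow> x \<le>\<^sub>M y \<oplus>\<^sub>M x \<odot>\<^sub>M \<sim>\<^sub>M y"
  by (simp flip: times_neg_le_iff)

lemma times_neg_triangle:
  assumes c: "x \<in> carrier A" "y \<in> carrier A" "z \<in> carrier A"
  shows "x \<odot>\<^sub>M \<sim>\<^sub>M z \<le>\<^sub>M x \<odot>\<^sub>M \<sim>\<^sub>M y \<oplus>\<^sub>M y \<odot>\<^sub>M \<sim>\<^sub>M z"
proof -
  have "y \<oplus>\<^sub>M x \<odot>\<^sub>M \<sim>\<^sub>M y \<le>\<^sub>M (z \<oplus>\<^sub>M y \<odot>\<^sub>M \<sim>\<^sub>M z) \<oplus>\<^sub>M x \<odot>\<^sub>M \<sim>\<^sub>M y"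
    using c by (intro plus_mono le_plus_times_neg) auto
  then have "x \<le>\<^sub>M (z \<oplus>\<^sub>M y \<odot>\<^sub>M \<sim>\<^sub>M z) \<oplus>\<^sub>M x \<odot>\<^sub>M \<sim>\<^sub>M y"
    using c by (rule_tac le_trans[OF le_plus_times_neg[of x y]]) auto
  then show ?thesis
    using c by (simp add: times_neg_le_iff plus_assoc plus_comm[of "x \<odot>\<^sub>M \<sim>\<^sub>M y"])
qed

lemma times_neg_plus_le:
  assumes c: "x \<in> carrier A" "y \<in> carrier A" "u \<in> carrier A" "v \<in> carrier A"
  shows "(x \<oplus>\<^sub>M u) \<odot>\<^sub>M \<sim>\<^sub>M (y \<oplus>\<^sub>M v) \<le>\<^sub>M x \<odot>\<^sub>M \<sim>\<^sub>M y \<oplus>\<^sub>M u \<odot>\<^sub>M \<sim>\<^sub>M v"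
proof -
  have "x \<oplus>\<^sub>M u \<le>\<^sub>M (y \<oplus>\<^sub>M x \<odot>\<^sub>M \<sim>\<^sub>M y) \<oplus>\<^sub>M (v \<oplus>\<^sub>M u \<odot>\<^sub>M \<sim>\<^sub>M v)"
    using c by (intro plus_mono le_plus_times_neg) auto
  then show ?thesis
    using c by (simp add: times_neg_le_iff plus_assoc plus_left_comm[of v])
qed

end

context mv_ideal
begin

lemma cong_iff:
  "(x, y) \<in> mv_cong A I \<longleftrightarrow> x \<in> carrier A \<and> y \<in> carrier A \<and>
     x \<odot>\<^sub>M \<sim>\<^sub>M y \<in> I \<and> y \<odot>\<^sub>M \<sim>\<^sub>M x \<in> I"
proof -
  have "a \<oplus>\<^sub>M b \<in> I \<longleftrightarrow> a \<in> I \<and> b \<in> I" if c: "a \<in> carrier A" "b \<in> carrier A" for a b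
  proof
    assume i: "a \<oplus>\<^sub>M b \<in> I"
    have "a \<in> I" using c by (intro ideal_down[OF i]) (auto simp: le_iff_plus)
    moreover have "b \<in> I"
      using c by (intro ideal_down[OF i]) (auto simp: le_iff_plus plus_comm[of a])
    ultimately show "a \<in> I \<and> b \<in> I" ..
  qed (simp add: ideal_plus)
  then have "mv_dist A x y \<in> I \<longleftrightarrow> x \<odot>\<^sub>M \<sim>\<^sub>M y \<in> I \<and> y \<odot>\<^sub>M \<sim>\<^sub>M x \<in> I"
    if "x \<in> carrier A" "y \<in> carrier A"
    using that by (simp add: mv_dist_def)
  then show ?thesis
    unfolding mv_cong_def by blast
qed

lemma equiv_cong: "equiv (carrier A) (mv_cong A I)"
proof (rule equivI)
  show "mv_cong A I \<subseteq> carrier A \<times> carrier A" by (auto simp: mv_cong_def)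
  show "refl_on (carrier A) (mv_cong A I)"
    by (auto simp: refl_on_def cong_iff times_neg mv_one_def[symmetric] ideal_zero)
  show "sym (mv_cong A I)" by (auto simp: sym_def cong_iff)
  have tr: "x \<odot>\<^sub>M \<sim>\<^sub>M z \<in> I"
    if "x \<in> carrier A" "y \<in> carrier A" "z \<in> carrier A" "x \<odot>\<^sub>M \<sim>\<^sub>M y \<in> I" "y \<odot>\<^sub>M \<sim>\<^sub>M z \<in> I"
    for x y z
    using ideal_down[OF ideal_plus[OF that(4,5)] _ times_neg_triangle[OF that(1-3)]] that(1,3)
    by simp
  show "trans (mv_cong A I)"
    unfolding trans_def cong_iff using tr by blast
qed

lemma cong_plus:
  assumes "(x, y) \<in> mv_cong A I" "(u, v) \<in> mv_cong A I"
  shows "(x \<oplus>\<^sub>M u, y \<oplus>\<^sub>M v) \<in> mv_cong A I"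
proof -
  have "(x \<oplus>\<^sub>M u) \<odot>\<^sub>M \<sim>\<^sub>M (y \<oplus>\<^sub>M v) \<in> I"
    if "x \<in> carrier A" "y \<in> carrier A" "u \<in> carrier A" "v \<in> carrier A"
      "x \<odot>\<^sub>M \<sim>\<^sub>M y \<in> I" "u \<odot>\<^sub>M \<sim>\<^sub>M v \<in> I" for x y u v
    using ideal_down[OF ideal_plus[OF that(5,6)] _ times_neg_plus_le[OF that(1-4)]] that(1-4)
    by simp
  then show ?thesis using assms by (simp add: cong_iff)
qed

lemma cong_neg:
  assumes "(x, y) \<in> mv_cong A I"
  shows "(\<sim>\<^sub>M x, \<sim>\<^sub>M y) \<in> mv_cong A I"
  using assms by (auto simp: cong_iff mv_times_def plus_comm)

lemma class_eq_iff:
  "\<lbrakk>x \<in> carrier A; y \<in> carrier A\<rbrakk> \<Longrightarrow> mv_class A I x = mv_class A I y \<longleftrightarrow> (x, y) \<in> mv_cong A I"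
  unfolding mv_class_def by (rule eq_equiv_class_iff[OF equiv_cong])

lemma quot_carrier: "carrier (mv_quot A I) = mv_class A I ` carrier A"
  by (auto simp: mv_quot_def quotient_def mv_class_def)

lemma quot_plus:
  assumes "x \<in> carrier A" "y \<in> carrier A"
  shows "mv_class A I x \<oplus>\<^sub>M\<^bsub>mv_quot A I\<^esub> mv_class A I y = mv_class A I (x \<oplus>\<^sub>M y)"
proof -
  have "congruent2 (mv_cong A I) (mv_cong A I) (\<lambda>x y. mv_class A I (x \<oplus>\<^sub>M y))"
    unfolding congruent2_def
    using cong_plus class_eq_iff by (auto simp: mv_cong_def)
  from UN_equiv_class2[OF equiv_cong equiv_cong this assms] show ?thesis
    by (simp add: mv_quot_def mv_class_def)
qed

lemma quot_neg:
  assumes "x \<in> carrier A"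
  shows "\<sim>\<^sub>M\<^bsub>mv_quot A I\<^esub> mv_class A I x = mv_class A I (\<sim>\<^sub>M x)"
proof -
  have "congruent (mv_cong A I) (\<lambda>x. mv_class A I (\<sim>\<^sub>M x))"
    unfolding congruent_def
    using cong_neg class_eq_iff by (auto simp: mv_cong_def)
  from UN_equiv_class[OF equiv_cong this assms] show ?thesis
    by (simp add: mv_quot_def mv_class_def)
qed

lemma quot_zero: "\<zero>\<^sub>M\<^bsub>mv_quot A I\<^esub> = mv_class A I \<zero>\<^sub>M"
  by (simp add: mv_quot_def)

lemma mv_algebra_quot: "mv_algebra (mv_quot A I)"
proof (rule mv_algebra.intro)
  show "comm_monoid \<lparr>carrier = carrier (mv_quot A I), mult = mv_plus (mv_quot A I),
          one = mv_zero (mv_quot A I)\<rparr>"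
    by (rule comm_monoidI)
      (auto simp: quot_carrier quot_plus quot_zero plus_ac)
qed (auto simp: quot_carrier quot_plus quot_neg quot_zero plus_neg_zero luk)

end

lemma mv_algebra_product:
  assumes "\<And>i. i \<in> \<Omega> \<Longrightarrow> mv_algebra (A i)"
  shows "mv_algebra (mv_product \<Omega> A)"
proof (rule mv_algebra.intro)
  show "comm_monoid \<lparr>carrier = carrier (mv_product \<Omega> A), mult = mv_plus (mv_product \<Omega> A),
          one = mv_zero (mv_product \<Omega> A)\<rparr>"
  proof (rule comm_monoidI, goal_cases)
    case (1 x y)
    then show ?case
      by (auto simp: mv_product_def assms mv_algebra.plus_closed PiE_iff)
  next
    case 2
    then show ?case
      by (auto simp: mv_product_def assms mv_algebra.zero_closed)
  next
    case (3 x y z)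
    then show ?case
      by (auto simp: mv_product_def fun_eq_iff assms mv_algebra.plus_assoc PiE_iff)
  next
    case (4 x)
    then show ?case
      by (auto simp: mv_product_def assms mv_algebra.zero_plus PiE_iff
          intro!: extensionalityI[of _ \<Omega>])
  next
    case (5 x y)
    then show ?case
      by (auto simp: mv_product_def restrict_def fun_eq_iff PiE_iff assms
          intro!: mv_algebra.plus_comm)
  qed
qed (auto simp: mv_product_def PiE_iff assms mv_algebra.neg_closed mv_algebra.neg_neg
    mv_algebra.plus_neg_zero mv_algebra.luk intro!: extensionalityI[of _ \<Omega>])

end

theory Submission imports Defs begin

text \<open>The componentwise quotient map \<open>f \<mapsto> (f i / I\<^sub>i)\<^sub>i\<close> is a surjective homomorphism from the
  product onto the product of the quotients. Since the distance is computed componentwise, its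
  kernel is the congruence of the product ideal, so the first isomorphism theorem applies.\<close>

text \<open>The direction of \<open>kernel\<close> from congruence to equal values lets
  \<open>\<phi>\<close> descend to classes; the converse direction makes the descended map
  injective. Surjectivity is inherited because every element of the quotient is the class of some
  \<open>x\<close>.\<close>

lemma (in mv_ideal) first_isomorphism:
  assumes hom: "\<phi> \<in> mv_hom A B"
    and surj: "\<phi> ` carrier A = carrier B"
    and kernel: "\<And>x y. \<lbrakk>x \<in> carrier A; y \<in> carrier A\<rbrakk> \<Longrightarrow> \<phi> x = \<phi> y \<longleftrightarrow> (x, y) \<in> mv_cong A I"
  shows "mv_quot A I \<cong>\<^sub>M B"
proof -
  \<comment> \<open>The image of a class under \<open>\<phi>\<close> turns out to be a singleton, so
    \<open>the_elem\<close> reads off the common value without choosing a representative.\<close>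
  define h where "h X = the_elem (\<phi> ` X)" for X
  have h: "h (mv_class A I x) = \<phi> x" if x: "x \<in> carrier A" for x
  proof -
    have "x \<in> mv_class A I x"
      unfolding mv_class_def by (rule equiv_class_self[OF equiv_cong x])
    moreover have "\<phi> y = \<phi> x" if "y \<in> mv_class A I x" for y
      using that kernel[of x y] by (auto simp: mv_class_def mv_cong_def)
    ultimately have "\<phi> ` mv_class A I x = {\<phi> x}" by blast
    then show ?thesis by (simp add: h_def)
  qed
  have "h \<in> mv_hom (mv_quot A I) B"
    using hom by (auto simp: mv_hom_def quot_carrier quot_plus quot_neg quot_zero h)
  moreover have "bij_betw h (carrier (mv_quot A I)) (carrier B)"
    unfolding bij_betw_def
  proof
    show "inj_on h (carrier (mv_quot A I))"
      by (auto simp: inj_on_def quot_carrier h kernel class_eq_iff)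
    show "h ` carrier (mv_quot A I) = carrier B"
      by (simp add: quot_carrier image_image h surj cong: image_cong)
  qed
  ultimately show ?thesis
    unfolding mv_isomorphic_def by blast
qed

lemma mv_product_simps:
  "carrier (mv_product \<Omega> A) = (\<Pi>\<^sub>E i\<in>\<Omega>. carrier (A i))"
  "f \<oplus>\<^sub>M\<^bsub>mv_product \<Omega> A\<^esub> g = (\<lambda>i\<in>\<Omega>. f i \<oplus>\<^sub>M\<^bsub>A i\<^esub> g i)"
  "\<sim>\<^sub>M\<^bsub>mv_product \<Omega> A\<^esub> f = (\<lambda>i\<in>\<Omega>. \<sim>\<^sub>M\<^bsub>A i\<^esub> f i)"
  "\<zero>\<^sub>M\<^bsub>mv_product \<Omega> A\<^esub> = (\<lambda>i\<in>\<Omega>. \<zero>\<^sub>M\<^bsub>A i\<^esub>)"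
  by (simp_all add: mv_product_def)

text \<open>The order is defined by an equation, and both sides of it are functions restricted to
  \<Omega>, so they agree exactly when they agree at each index in \<Omega>.\<close>

lemma mv_product_le_iff:
  "f \<le>\<^sub>M\<^bsub>mv_product \<Omega> A\<^esub> g \<longleftrightarrow> (\<forall>i\<in>\<Omega>. f i \<le>\<^sub>M\<^bsub>A i\<^esub> g i)"
  by (auto simp: mv_le_def mv_one_def mv_product_simps fun_eq_iff restrict_def)

lemma mv_product_dist:
  "mv_dist (mv_product \<Omega> A) f g = (\<lambda>i\<in>\<Omega>. mv_dist (A i) (f i) (g i))"
  by (auto simp: mv_dist_def mv_times_def mv_product_simps)

text \<open>The distance of \<open>f\<close> and \<open>g\<close> is itself restricted to \<Omega>,
  so it lies in the extensional product of the \<open>I i\<close> as soon as each coordinate lies in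
  its \<open>I i\<close>.\<close>

lemma mv_product_cong_iff:
  assumes "f \<in> carrier (mv_product \<Omega> A)" "g \<in> carrier (mv_product \<Omega> A)"
  shows "(f, g) \<in> mv_cong (mv_product \<Omega> A) (\<Pi>\<^sub>E i\<in>\<Omega>. I i) \<longleftrightarrow>
    (\<forall>i\<in>\<Omega>. (f i, g i) \<in> mv_cong (A i) (I i))"
  using assms by (auto simp: mv_cong_def mv_product_dist mv_product_simps PiE_iff)

lemma mv_ideal_product:
  assumes "\<And>i. i \<in> \<Omega> \<Longrightarrow> mv_ideal (I i) (A i)"
  shows "mv_ideal (\<Pi>\<^sub>E i\<in>\<Omega>. I i) (mv_product \<Omega> A)"
proof (intro mv_ideal.intro mv_ideal_axioms.intro)
  show "mv_algebra (mv_product \<Omega> A)"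
    using assms by (intro mv_algebra_product) (simp add: mv_ideal_def)
  show "(\<Pi>\<^sub>E i\<in>\<Omega>. I i) \<subseteq> carrier (mv_product \<Omega> A)"
    unfolding mv_product_simps by (intro PiE_mono mv_ideal.ideal_subset assms)
  show "\<zero>\<^sub>M\<^bsub>mv_product \<Omega> A\<^esub> \<in> (\<Pi>\<^sub>E i\<in>\<Omega>. I i)"
    by (simp add: mv_product_simps mv_ideal.ideal_zero assms)
  show "f \<oplus>\<^sub>M\<^bsub>mv_product \<Omega> A\<^esub> g \<in> (\<Pi>\<^sub>E i\<in>\<Omega>. I i)"
    if "f \<in> (\<Pi>\<^sub>E i\<in>\<Omega>. I i)" "g \<in> (\<Pi>\<^sub>E i\<in>\<Omega>. I i)" for f g
    using that by (auto simp: mv_product_simps intro!: mv_ideal.ideal_plus assms)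
  show "f \<in> (\<Pi>\<^sub>E i\<in>\<Omega>. I i)"
    if fg: "g \<in> (\<Pi>\<^sub>E i\<in>\<Omega>. I i)" "f \<in> carrier (mv_product \<Omega> A)" "f \<le>\<^sub>M\<^bsub>mv_product \<Omega> A\<^esub> g" for f g
  proof (rule PiE_I)
    show "f i \<in> I i" if i: "i \<in> \<Omega>" for i
    proof (rule mv_ideal.ideal_down[OF assms[OF i]])
      show "g i \<in> I i" "f i \<in> carrier (A i)" "f i \<le>\<^sub>M\<^bsub>A i\<^esub> g i"
        using fg i by (auto simp: mv_product_simps mv_product_le_iff)
    qed
    \<comment> \<open>The order says nothing outside \<Omega>; the default value there comes from
      \<open>f\<close> being in the carrier.\<close>
    show "f i = undefined" if "i \<notin> \<Omega>" for i
      using fg(2) that by (auto simp: mv_product_simps)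
  qed
qed

lemma mv_product_class_hom:
  assumes "\<And>i. i \<in> \<Omega> \<Longrightarrow> mv_ideal (I i) (A i)"
  shows "(\<lambda>f. \<lambda>i\<in>\<Omega>. mv_class (A i) (I i) (f i))
    \<in> mv_hom (mv_product \<Omega> A) (mv_product \<Omega> (\<lambda>i. mv_quot (A i) (I i)))"
  using assms
  by (auto simp: mv_hom_def mv_product_simps PiE_iff mv_ideal.quot_carrier mv_ideal.quot_plus
      mv_ideal.quot_neg mv_ideal.quot_zero intro!: restrict_ext)

lemma mv_product_class_surj:
  assumes "\<And>i. i \<in> \<Omega> \<Longrightarrow> mv_ideal (I i) (A i)"
  shows "(\<lambda>f. \<lambda>i\<in>\<Omega>. mv_class (A i) (I i) (f i)) ` carrier (mv_product \<Omega> A)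
    = carrier (mv_product \<Omega> (\<lambda>i. mv_quot (A i) (I i)))" (is "?\<phi> ` _ = _")
proof
  show "?\<phi> ` carrier (mv_product \<Omega> A) \<subseteq> carrier (mv_product \<Omega> (\<lambda>i. mv_quot (A i) (I i)))"
    using assms by (auto simp: mv_product_simps mv_ideal.quot_carrier PiE_iff)
  show "carrier (mv_product \<Omega> (\<lambda>i. mv_quot (A i) (I i))) \<subseteq> ?\<phi> ` carrier (mv_product \<Omega> A)"
  proof
    fix F assume F: "F \<in> carrier (mv_product \<Omega> (\<lambda>i. mv_quot (A i) (I i)))"
    then have "\<forall>i\<in>\<Omega>. \<exists>x. x \<in> carrier (A i) \<and> F i = mv_class (A i) (I i) x"
      using assms by (fastforce simp: mv_product_simps PiE_iff mv_ideal.quot_carrier)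
    \<comment> \<open>The axiom of choice picks representatives for all coordinates at once.\<close>
    then obtain f where f: "\<forall>i\<in>\<Omega>. f i \<in> carrier (A i) \<and> F i = mv_class (A i) (I i) (f i)"
      by metis
    \<comment> \<open>The choice function is arbitrary outside \<Omega>, so it is restricted to
      become an element of the product.\<close>
    then have "F = ?\<phi> (restrict f \<Omega>)"
      using F by (auto simp: mv_product_simps PiE_iff intro!: extensionalityI[of _ \<Omega>])
    moreover have "restrict f \<Omega> \<in> carrier (mv_product \<Omega> A)"
      using f by (simp add: mv_product_simps)
    ultimately show "F \<in> ?\<phi> ` carrier (mv_product \<Omega> A)" by blast
  qed
qed

text \<open>This supplies the kernel condition of \<open>first_isomorphism\<close>: equality of the
  two tuples is equality of classes at each index, which is congruence at each index, and
  \<open>mv_product_cong_iff\<close> assembles these into one congruence in the product.\<close>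

lemma mv_product_class_eq_iff:
  assumes "\<And>i. i \<in> \<Omega> \<Longrightarrow> mv_ideal (I i) (A i)"
    and f: "f \<in> carrier (mv_product \<Omega> A)" and g: "g \<in> carrier (mv_product \<Omega> A)"
  shows "(\<lambda>i\<in>\<Omega>. mv_class (A i) (I i) (f i)) = (\<lambda>i\<in>\<Omega>. mv_class (A i) (I i) (g i)) \<longleftrightarrow>
    (f, g) \<in> mv_cong (mv_product \<Omega> A) (\<Pi>\<^sub>E i\<in>\<Omega>. I i)"
proof -
  have "(\<lambda>i\<in>\<Omega>. mv_class (A i) (I i) (f i)) = (\<lambda>i\<in>\<Omega>. mv_class (A i) (I i) (g i)) \<longleftrightarrow>
      (\<forall>i\<in>\<Omega>. mv_class (A i) (I i) (f i) = mv_class (A i) (I i) (g i))"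
    by (auto simp: fun_eq_iff restrict_def)
  also have "\<dots> \<longleftrightarrow> (\<forall>i\<in>\<Omega>. (f i, g i) \<in> mv_cong (A i) (I i))"
    using f g by (intro ball_cong refl mv_ideal.class_eq_iff assms)
      (auto simp: mv_product_simps)
  finally show ?thesis
    using f g by (simp add: mv_product_cong_iff)
qed

theorem theorem2p9:
  fixes \<Omega> :: "'i set" and A :: "'i \<Rightarrow> 'a mv_struct" and I :: "'i \<Rightarrow> 'a set"
  assumes "\<And>i. i \<in> \<Omega> \<Longrightarrow> mv_algebra (A i)"
    and "\<And>i. i \<in> \<Omega> \<Longrightarrow> mv_ideal (I i) (A i)"
  shows "mv_ideal (\<Pi>\<^sub>E i\<in>\<Omega>. I i) (mv_product \<Omega> A) \<and>
    mv_quot (mv_product \<Omega> A) (\<Pi>\<^sub>E i\<in>\<Omega>. I i) \<cong>\<^sub>M mv_product \<Omega> (\<lambda>i. mv_quot (A i) (I i))"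
proof
  show ideal: "mv_ideal (\<Pi>\<^sub>E i\<in>\<Omega>. I i) (mv_product \<Omega> A)"
    by (rule mv_ideal_product[OF assms(2)])
  show "mv_quot (mv_product \<Omega> A) (\<Pi>\<^sub>E i\<in>\<Omega>. I i) \<cong>\<^sub>M mv_product \<Omega> (\<lambda>i. mv_quot (A i) (I i))"
    by (rule mv_ideal.first_isomorphism[OF ideal mv_product_class_hom[OF assms(2)]
          mv_product_class_surj[OF assms(2)] mv_product_class_eq_iff[OF assms(2)]])
qed

end
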